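(* Let $\mathbb{K}$ be a commutative field, let $\mathcal{A}=\{H_1,\dots,H_n\}$ be a generic arrangement of $n$ lines in $\mathbb{K}^2$ with normal vectors $\alpha_1,\dots,\alpha_n$, and let $p_0,p_1,\dots,p_6\in\{1,\dots,n\}$ be distinct indices. Let $$\mathbb{T}=\{\{p_0,p_1,p_4\},\{p_0,p_2,p_5\},\{p_0,p_3,p_6\},\{p_1,p_2,p_3\},\{p_4,p_5,p_6\}\}.$$ A simple intersection $X=\bigcap_{L\in\mathbb{T}}D_L$ of hyperplanes in $\mathcal{B}(n,2,\mathcal{A})$ is a quintuple point if and only if $$[\alpha_{p_0},\alpha_{p_1};\alpha_{p_2},\alpha_{p_3}]=[\alpha_{p_0},\alpha_{p_4};\alpha_{p_5},\alpha_{p_6}].$$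
   Context: A generic arrangement of $n$ lines in $\mathbb{K}^2$ is a central arrangement of $n$ pairwise distinct lines $H_1,\dots,H_n$ through the origin; $\alpha_p$ is a nonzero vector normal to $H_p$, viewed as a linear form with kernel $H_p$. Its translates $\{H_1^{x_1},\dots,H_n^{x_n}\}$, with $H_i^{x_i}$ parallel to $H_i$ (up to rescaling of the coordinate $x_i$, $H_i^{x_i}=\{v:\alpha_i(v)=x_i\}$), are parametrized by $(x_1,\dots,x_n)\in\mathbb{K}^n$. For $L\subset[n]=\{1,\dots,n\}$ with $|L|=3$, $D_L\subset\mathbb{K}^n$ is the hyperplane of translates whose three lines indexed by $L$ have a common point. The discriminantal arrangement $\mathcal{B}(n,2,\mathcal{A})$ is the arrangement of all hyperplanes $D_L$, $|L|=3$. For $S\subset[n]$ with $|S|\ge3$, $D_S=\bigcap_{L\subset S,|L|=3}D_L$. An intersection $X=\bigcap_{i=1}^rD_{L_i}$ with $|L_i|=3$ is simple if for every $I\subset[r]$ with $|I|\ge2$ and every $S$ with $|S|>3$ one has $\bigcap_{i\in I}D_{L_i}\ne D_S$. The number $r$ of hyperplanes intersecting in $X$ is its multiplicity; the rank of $X$ is its codimension in $\mathbb{K}^n$. A quintuple point is a simple intersection of multiplicity $5$ and rank $4$. $|v\,w|$ denotes the determinant of the $2\times 2$ matrix with columns $v,w$, and the cross ratio is $[v_1,v_2;v_3,v_4]=\dfrac{|v_1v_3|\,|v_2v_4|}{|v_2v_3|\,|v_1v_4|}$. *)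

theory Defs
  imports "HOL-Analysis.Analysis"
begin

text \<open>
  The index set \<open>[n]\<close> is a finite type \<open>'n\<close>, and \<open>\<K>\<close> is a type \<open>'a\<close> of class \<open>field\<close>;
  thus the plane is \<open>'a^2\<close> and the space of translates is \<open>'a^'n\<close>. Subspaces and dimensions
  over \<open>'a\<close> are \<open>vec.subspace\<close> and \<open>vec.dim\<close>.
\<close>

definition generic_arrangement :: "('n::finite \<Rightarrow> ('a::field^2) set) \<Rightarrow> bool" where
  "generic_arrangement H \<longleftrightarrow> (\<forall>p. vec.subspace (H p) \<and> vec.dim (H p) = 1) \<and> inj H"

definition normal_vector :: "('a::field^2) set \<Rightarrow> 'a^2 \<Rightarrow> bool" where
  "normal_vector l a \<longleftrightarrow> a \<noteq> 0 \<and> l = {v. scalar_product a v = 0}"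

definition translate :: "('n::finite \<Rightarrow> 'a::field^2) \<Rightarrow> 'a^'n \<Rightarrow> 'n \<Rightarrow> ('a^2) set" where
  "translate \<alpha> x i = {v. scalar_product (\<alpha> i) v = x $ i}"

definition D_triple :: "('n::finite \<Rightarrow> 'a::field^2) \<Rightarrow> 'n set \<Rightarrow> ('a^'n) set" where
  "D_triple \<alpha> L = {x. (\<Inter>i\<in>L. translate \<alpha> x i) \<noteq> {}}"

definition discriminantal_arrangement ::
    "('n::finite \<Rightarrow> 'a::field^2) \<Rightarrow> ('a^'n) set set" where
  "discriminantal_arrangement \<alpha> = {D_triple \<alpha> L |L. card L = 3}"

definition D_set :: "('n::finite \<Rightarrow> 'a::field^2) \<Rightarrow> 'n set \<Rightarrow> ('a^'n) set" where
  "D_set \<alpha> S = (\<Inter>L\<in>{L. L \<subseteq> S \<and> card L = 3}. D_triple \<alpha> L)"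

text \<open>
  Simplicity and multiplicity refer to the family of hyperplanes by which the intersection is
  presented, so the family \<open>\<H>\<close> is an argument alongside the intersection \<open>X\<close> itself.
  The subfamily \<open>\<I>\<close> below may be all of \<open>\<H>\<close>.
\<close>

definition simple_intersection ::
    "('n::finite \<Rightarrow> 'a::field^2) \<Rightarrow> ('a^'n) set set \<Rightarrow> ('a^'n) set \<Rightarrow> bool" where
  "simple_intersection \<alpha> \<H> X \<longleftrightarrow>
     \<H> \<subseteq> discriminantal_arrangement \<alpha> \<and> X = \<Inter>\<H> \<and>
     (\<forall>\<I> S. \<I> \<subseteq> \<H> \<longrightarrow> card \<I> \<ge> 2 \<longrightarrow> card S > 3 \<longrightarrow> \<Inter>\<I> \<noteq> D_set \<alpha> S)"

definition codimension :: "('a::field^'n::finite) set \<Rightarrow> nat" where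
  "codimension X = CARD('n) - vec.dim X"

definition quintuple_point ::
    "('n::finite \<Rightarrow> 'a::field^2) \<Rightarrow> ('a^'n) set set \<Rightarrow> ('a^'n) set \<Rightarrow> bool" where
  "quintuple_point \<alpha> \<H> X \<longleftrightarrow> simple_intersection \<alpha> \<H> X \<and> card \<H> = 5 \<and> codimension X = 4"

text \<open>\<open>vector [v, w]\<close> has rows \<open>v\<close> and \<open>w\<close>, hence the transposition.\<close>

definition det2 :: "'a::field^2 \<Rightarrow> 'a^2 \<Rightarrow> 'a" where
  "det2 v w = det (transpose (vector [v, w] :: 'a^2^2))"

definition cross_ratio :: "'a::field^2 \<Rightarrow> 'a^2 \<Rightarrow> 'a^2 \<Rightarrow> 'a^2 \<Rightarrow> 'a" where
  "cross_ratio v\<^sub>1 v\<^sub>2 v\<^sub>3 v\<^sub>4 = (det2 v\<^sub>1 v\<^sub>3 * det2 v\<^sub>2 v\<^sub>4) / (det2 v\<^sub>2 v\<^sub>3 * det2 v\<^sub>1 v\<^sub>4)"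

end

theory Submission
  imports Defs
begin

text \<open>
  A hyperplane \<open>D\<^sub>{\<^sub>i\<^sub>,\<^sub>j\<^sub>,\<^sub>k\<^sub>}\<close> is the kernel of a linear form with nonzero coefficients exactly at
  \<open>i\<close>, \<open>j\<close>, \<open>k\<close>, and it is invariant under translating all lines by a common vector.
  The first four hyperplanes of the family are independent, because each of them involves an index
  (\<open>p\<^sub>3\<close>, \<open>p\<^sub>4\<close>, \<open>p\<^sub>5\<close>, \<open>p\<^sub>6\<close>) on which the preceding ones do not depend. So the rank is 4 iff the
  last form vanishes on their intersection. Moving the intersection point of the lines \<open>p\<^sub>0\<close> and
  \<open>p\<^sub>1\<close> to the origin leaves a one-parameter family of translates, on which the last form is a
  multiple of the difference of the two sides of the cleared cross ratio equation.
\<close>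

section \<open>Determinants and normal vectors in the plane\<close>

lemma scalar_product_2: "scalar_product (a::'a::field^2) v = a $ 1 * v $ 1 + a $ 2 * v $ 2"
  by (simp add: scalar_product_def sum_2)

lemma det2_eq: "det2 (v::'a::field^2) w = v $ 1 * w $ 2 - v $ 2 * w $ 1"
  by (simp add: det2_def det_2 transpose_def vector_2 mult.commute)

text \<open>Since \<open>a $ 1 * b $ 2 = a $ 2 * b $ 1\<close>, each coordinate of \<open>a\<close>
  times \<open>scalar_product b v\<close> is the same coordinate of \<open>b\<close> times
  \<open>scalar_product a v\<close>; and some coordinate of \<open>a\<close> is nonzero.\<close>

lemma scalar_product_eq_0_transfer:
  fixes a b v :: "'a::field^2"
  assumes "a \<noteq> 0" "det2 a b = 0" "scalar_product a v = 0"
  shows "scalar_product b v = 0"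
proof -
  have e: "a $ 1 * b $ 2 = a $ 2 * b $ 1" "a $ 1 * v $ 1 + a $ 2 * v $ 2 = 0"
    using assms by (simp_all add: det2_eq scalar_product_2)
  have "a $ 1 * (b $ 1 * v $ 1 + b $ 2 * v $ 2) = 0" "a $ 2 * (b $ 1 * v $ 1 + b $ 2 * v $ 2) = 0"
    using e by algebra+
  moreover have "a $ 1 \<noteq> 0 \<or> a $ 2 \<noteq> 0"
    using assms(1) by (auto simp: vec_eq_iff forall_2)
  ultimately show ?thesis by (auto simp: scalar_product_2)
qed

text \<open>Two normals with vanishing determinant have the same kernel, by transfer in both
  directions, which contradicts the injectivity of \<open>H\<close>.\<close>

lemma generic_det2_nonzero:
  assumes "generic_arrangement H" "\<And>p. normal_vector (H p) (\<alpha> p)" "i \<noteq> j"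
  shows "det2 (\<alpha> i) (\<alpha> j) \<noteq> 0"
proof
  assume d: "det2 (\<alpha> i) (\<alpha> j) = 0"
  then have d': "det2 (\<alpha> j) (\<alpha> i) = 0"
    by (simp add: det2_eq mult.commute)
  have n: "\<alpha> p \<noteq> 0" "H p = {v. scalar_product (\<alpha> p) v = 0}" for p
    using assms(2)[of p] by (auto simp: normal_vector_def)
  have "H i = H j"
    using scalar_product_eq_0_transfer[OF n(1) d] scalar_product_eq_0_transfer[OF n(1) d']
    by (auto simp: n(2))
  with assms(1,3) show False
    by (auto simp: generic_arrangement_def inj_def)
qed

section \<open>The linear form cutting out a hyperplane of the arrangement\<close>

text \<open>The determinant of the 3 by 3 matrix with rows
  \<open>(x $ l, \<alpha> l $ 1, \<alpha> l $ 2)\<close> for \<open>l\<close> equal to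
  \<open>i\<close>, \<open>j\<close>, \<open>k\<close>, expanded along the first column: the
  consistency condition for three equations in two unknowns.\<close>

definition triple_form :: "('n::finite \<Rightarrow> 'a::field^2) \<Rightarrow> 'n \<Rightarrow> 'n \<Rightarrow> 'n \<Rightarrow> 'a^'n \<Rightarrow> 'a" where
  "triple_form \<alpha> i j k x =
     x $ i * det2 (\<alpha> j) (\<alpha> k) - x $ j * det2 (\<alpha> i) (\<alpha> k) + x $ k * det2 (\<alpha> i) (\<alpha> j)"

lemma cramer_2:
  fixes a b :: "'a::field^2"
  assumes "det2 a b \<noteq> 0"
  obtains v where "scalar_product a v = s" "scalar_product b v = t"
proof
  let ?v = "vector [(s * b $ 2 - t * a $ 2) / det2 a b, (t * a $ 1 - s * b $ 1) / det2 a b] :: 'a^2"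
  have "a $ 1 * (s * b $ 2 - t * a $ 2) + a $ 2 * (t * a $ 1 - s * b $ 1) = s * det2 a b"
    "b $ 1 * (s * b $ 2 - t * a $ 2) + b $ 2 * (t * a $ 1 - s * b $ 1) = t * det2 a b"
    by (simp_all add: det2_eq algebra_simps)
  then show "scalar_product a ?v = s" "scalar_product b ?v = t"
    using assms by (simp_all add: scalar_product_2 vector_2 add_divide_distrib[symmetric])
qed

text \<open>The first column of the determinant is here a combination of the other two. By
  additivity, moving all lines by a common vector does not change the form.\<close>

lemma triple_form_scalar_product:
  "triple_form \<alpha> i j k (\<chi> l. scalar_product (\<alpha> l) v) = 0"
  by (simp add: triple_form_def scalar_product_2 det2_eq algebra_simps)

lemma triple_form_add:
  "triple_form \<alpha> i j k (x + y) = triple_form \<alpha> i j k x + triple_form \<alpha> i j k y"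
  by (simp add: triple_form_def algebra_simps)

lemma triple_form_scale: "triple_form \<alpha> i j k (c *s x) = c * triple_form \<alpha> i j k x"
  by (simp add: triple_form_def algebra_simps)

lemma linear_triple_form: "Vector_Spaces.linear (*s) (*) (triple_form \<alpha> i j k)"
  unfolding Vector_Spaces.linear_iff
  by (intro conjI allI vec.vector_space_axioms vector_space_over_itself.vector_space_axioms
      triple_form_add triple_form_scale)

lemma triple_form_minus:
  "triple_form \<alpha> i j k (x - y) = triple_form \<alpha> i j k x - triple_form \<alpha> i j k y"
  by (simp add: triple_form_def algebra_simps)

text \<open>The lines \<open>i\<close> and \<open>j\<close> meet in a point \<open>v\<close>. The
  coefficient of \<open>x $ k\<close> in the form is nonzero, so its vanishing forces
  \<open>x $ k\<close> to be the value that puts line \<open>k\<close> through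
  \<open>v\<close>.\<close>

lemma D_triple_eq:
  assumes "det2 (\<alpha> i) (\<alpha> j) \<noteq> 0"
  shows "D_triple \<alpha> {i, j, k} = {x. triple_form \<alpha> i j k x = 0}"
proof (intro set_eqI iffI; simp only: mem_Collect_eq)
  fix x assume "x \<in> D_triple \<alpha> {i, j, k}"
  then obtain v where "scalar_product (\<alpha> i) v = x $ i" "scalar_product (\<alpha> j) v = x $ j"
    "scalar_product (\<alpha> k) v = x $ k"
    by (auto simp: D_triple_def translate_def)
  then show "triple_form \<alpha> i j k x = 0"
    using triple_form_scalar_product[of \<alpha> i j k v] by (simp add: triple_form_def)
next
  fix x assume x: "triple_form \<alpha> i j k x = 0"
  obtain v where v: "scalar_product (\<alpha> i) v = x $ i" "scalar_product (\<alpha> j) v = x $ j"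
    using cramer_2[OF assms] by metis
  \<comment> \<open>Both \<open>x\<close> and the translate with all lines through \<open>v\<close>
    annihilate the form, and they agree at \<open>i\<close> and \<open>j\<close>; compare the
    remaining terms.\<close>
  have "scalar_product (\<alpha> k) v * det2 (\<alpha> i) (\<alpha> j) = x $ k * det2 (\<alpha> i) (\<alpha> j)"
    using x triple_form_scalar_product[of \<alpha> i j k v] v
    by (simp only: triple_form_def vec_lambda_beta) algebra
  then have "scalar_product (\<alpha> k) v = x $ k"
    using assms by simp
  with v show "x \<in> D_triple \<alpha> {i, j, k}"
    by (auto simp: D_triple_def translate_def)
qed

text \<open>For \<open>k\<close> in \<open>L\<close> but not in \<open>M\<close>, move only line
  \<open>k\<close> off the origin: the lines of \<open>M\<close> still meet there, while the form of
  \<open>L\<close> takes the nonzero value \<open>det2 (\<alpha> i) (\<alpha> j)\<close>.\<close>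

lemma inj_on_D_triple:
  fixes \<alpha> :: "'n::finite \<Rightarrow> 'a::field^2"
  assumes nz: "\<And>i j. i \<noteq> j \<Longrightarrow> det2 (\<alpha> i) (\<alpha> j) \<noteq> 0"
  shows "inj_on (D_triple \<alpha>) {L. card L = 3}"
proof (rule inj_onI, rule ccontr)
  fix L M :: "'n set"
  assume c: "L \<in> {L. card L = 3}" "M \<in> {L. card L = 3}"
    and eq: "D_triple \<alpha> L = D_triple \<alpha> M" and "L \<noteq> M"
  then have "\<not> L \<subseteq> M"
    using card_subset_eq[of M L] by auto
  then obtain k where k: "k \<in> L" "k \<notin> M" by auto
  have "0 \<in> (\<Inter>i\<in>M. translate \<alpha> (axis k 1) i)"
    using k(2) by (auto simp: translate_def axis_def scalar_product_def)
  then have "axis k 1 \<in> D_triple \<alpha> M"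
    by (auto simp: D_triple_def)
  moreover have "card (L - {k}) = 2"
    using c k by simp
  then obtain i j where ij: "L - {k} = {i, j}" "i \<noteq> j"
    by (auto simp: card_2_iff)
  then have L: "L = {i, j, k}" "i \<noteq> k" "j \<noteq> k"
    using k by auto
  ultimately have "triple_form \<alpha> i j k (axis k 1) = 0"
    using eq D_triple_eq[OF nz[OF ij(2)]] by auto
  then show False
    using nz[OF ij(2)] L by (simp add: triple_form_def axis_def)
qed

section \<open>Dimension count for the rank\<close>

text \<open>The vector \<open>w\<close> spans a complement of the kernel of \<open>f\<close> within
  \<open>S\<close>: subtracting a suitable multiple of \<open>w\<close> moves any vector of
  \<open>S\<close> into the kernel.\<close>

lemma dim_Int_kernel:
  fixes S :: "('a::field^'n::finite) set" and f :: "'a^'n \<Rightarrow> 'a"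
  assumes S: "vec.subspace S" and f: "Vector_Spaces.linear (*s) (*) f"
    and w: "w \<in> S" "f w \<noteq> 0"
  shows "vec.dim S = vec.dim (S \<inter> {x. f x = 0}) + 1"
proof -
  interpret f: Vector_Spaces.linear "(*s)" "(*)" f by (fact f)
  let ?K = "S \<inter> {x. f x = 0}"
  have K: "vec.subspace ?K"
    by (intro vec.subspace_inter S f.subspace_kernel)
  have "S \<subseteq> vec.span (insert w ?K)"
  proof
    fix x assume x: "x \<in> S"
    have "x - (f x / f w) *s w \<in> ?K"
      using x w S by (auto simp: f.diff f.scale vec.subspace_diff vec.subspace_scale)
    then show "x \<in> vec.span (insert w ?K)"
      unfolding vec.span_insert by (intro CollectI exI vec.span_base)
  qed
  moreover have "insert w ?K \<subseteq> S"
    using w by auto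
  ultimately have "vec.dim S = vec.dim (insert w ?K)"
    by (intro antisym vec.dim_mono vec.dim_subset)
  also have "\<dots> = vec.dim ?K + 1"
    using w K by (simp add: vec.dim_insert vec.span_eq_iff[THEN iffD2])
  finally show ?thesis .
qed

lemma rank_four_iff_last_form_vanishes:
  fixes \<alpha> :: "'n::finite \<Rightarrow> 'a::field^2"
  assumes nz: "\<And>i j. i \<noteq> j \<Longrightarrow> det2 (\<alpha> i) (\<alpha> j) \<noteq> 0"
    and dist: "distinct [p\<^sub>0, p\<^sub>1, p\<^sub>2, p\<^sub>3, p\<^sub>4, p\<^sub>5, p\<^sub>6]"
    and Y: "Y = {x. triple_form \<alpha> p\<^sub>1 p\<^sub>2 p\<^sub>3 x = 0} \<inter> {x. triple_form \<alpha> p\<^sub>0 p\<^sub>1 p\<^sub>4 x = 0}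
      \<inter> {x. triple_form \<alpha> p\<^sub>0 p\<^sub>2 p\<^sub>5 x = 0} \<inter> {x. triple_form \<alpha> p\<^sub>0 p\<^sub>3 p\<^sub>6 x = 0}"
  shows "codimension (Y \<inter> {x. triple_form \<alpha> p\<^sub>4 p\<^sub>5 p\<^sub>6 x = 0}) = 4 \<longleftrightarrow>
    (\<forall>x\<in>Y. triple_form \<alpha> p\<^sub>4 p\<^sub>5 p\<^sub>6 x = 0)"
proof -
  let ?f = "triple_form \<alpha>"
  have sub: "vec.subspace {x. ?f i j k x = 0}" for i j k
    by (simp add: vec.subspace_def triple_form_add triple_form_scale) (simp add: triple_form_def)
  let ?A = "{x. ?f p\<^sub>1 p\<^sub>2 p\<^sub>3 x = 0}" and ?B = "{x. ?f p\<^sub>0 p\<^sub>1 p\<^sub>4 x = 0}"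
    and ?C = "{x. ?f p\<^sub>0 p\<^sub>2 p\<^sub>5 x = 0}"
  note ax = triple_form_def axis_def nz
  \<comment> \<open>In each of the four steps, the unit vector at the index new to the added form is
    annihilated by the earlier forms but not by the added one.\<close>
  have "vec.dim (UNIV :: ('a^'n) set) = vec.dim ?A + 1"
    using dim_Int_kernel[OF vec.subspace_UNIV linear_triple_form[of \<alpha> p\<^sub>1 p\<^sub>2 p\<^sub>3], of "axis p\<^sub>3 1"] dist
    by (simp add: ax)
  moreover have "vec.dim ?A = vec.dim (?A \<inter> ?B) + 1"
    using dist by (intro dim_Int_kernel[of _ _ "axis p\<^sub>4 1"] vec.subspace_inter sub linear_triple_form)
      (auto simp: ax)
  moreover have "vec.dim (?A \<inter> ?B) = vec.dim (?A \<inter> ?B \<inter> ?C) + 1"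
    using dist by (intro dim_Int_kernel[of _ _ "axis p\<^sub>5 1"] vec.subspace_inter sub linear_triple_form)
      (auto simp: ax)
  moreover have "vec.dim (?A \<inter> ?B \<inter> ?C) = vec.dim Y + 1"
    unfolding Y using dist
    by (intro dim_Int_kernel[of _ _ "axis p\<^sub>6 1"] vec.subspace_inter sub linear_triple_form)
      (auto simp: ax)
  \<comment> \<open>As a sum, this makes the truncated subtraction in \<open>codimension\<close>
    exact.\<close>
  ultimately have dimY: "CARD('n) = vec.dim Y + 4"
    unfolding vec_dim_card by linarith
  have subY: "vec.subspace Y"
    unfolding Y by (intro vec.subspace_inter sub)
  show ?thesis
  proof
    assume c: "codimension (Y \<inter> {x. ?f p\<^sub>4 p\<^sub>5 p\<^sub>6 x = 0}) = 4"
    show "\<forall>x\<in>Y. ?f p\<^sub>4 p\<^sub>5 p\<^sub>6 x = 0"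
    proof (intro ballI, rule ccontr)
      \<comment> \<open>Such a \<open>w\<close> would lower the dimension once more and make the
        codimension 5.\<close>
      fix w assume "w \<in> Y" "?f p\<^sub>4 p\<^sub>5 p\<^sub>6 w \<noteq> 0"
      from dim_Int_kernel[OF subY linear_triple_form this] c dimY show False
        by (simp add: codimension_def)
    qed
  next
    assume "\<forall>x\<in>Y. ?f p\<^sub>4 p\<^sub>5 p\<^sub>6 x = 0"
    then have "Y \<inter> {x. ?f p\<^sub>4 p\<^sub>5 p\<^sub>6 x = 0} = Y" by auto
    then show "codimension (Y \<inter> {x. ?f p\<^sub>4 p\<^sub>5 p\<^sub>6 x = 0}) = 4"
      using dimY by (simp add: codimension_def)
  qed
qed

section \<open>The cross ratio as the condition for dependence\<close>

lemma last_form_vanishes_iff: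
  fixes \<alpha> :: "'n::finite \<Rightarrow> 'a::field^2"
  assumes nz: "\<And>i j. i \<noteq> j \<Longrightarrow> det2 (\<alpha> i) (\<alpha> j) \<noteq> 0"
    and dist: "distinct [p\<^sub>0, p\<^sub>1, p\<^sub>2, p\<^sub>3, p\<^sub>4, p\<^sub>5, p\<^sub>6]"
    and Y: "Y = {x. triple_form \<alpha> p\<^sub>1 p\<^sub>2 p\<^sub>3 x = 0} \<inter> {x. triple_form \<alpha> p\<^sub>0 p\<^sub>1 p\<^sub>4 x = 0}
      \<inter> {x. triple_form \<alpha> p\<^sub>0 p\<^sub>2 p\<^sub>5 x = 0} \<inter> {x. triple_form \<alpha> p\<^sub>0 p\<^sub>3 p\<^sub>6 x = 0}"
  shows "(\<forall>x\<in>Y. triple_form \<alpha> p\<^sub>4 p\<^sub>5 p\<^sub>6 x = 0) \<longleftrightarrow>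
    cross_ratio (\<alpha> p\<^sub>0) (\<alpha> p\<^sub>1) (\<alpha> p\<^sub>2) (\<alpha> p\<^sub>3) = cross_ratio (\<alpha> p\<^sub>0) (\<alpha> p\<^sub>4) (\<alpha> p\<^sub>5) (\<alpha> p\<^sub>6)"
proof -
  define d where "d i j = det2 (\<alpha> i) (\<alpha> j)" for i j
  let ?f = "triple_form \<alpha>"
  have dnz: "d i j \<noteq> 0" if "i \<noteq> j" for i j
    using nz[OF that] by (simp add: d_def)
  \<comment> \<open>The cross ratios are compared after clearing their nonzero denominators.\<close>
  have cr: "cross_ratio (\<alpha> p\<^sub>0) (\<alpha> p\<^sub>1) (\<alpha> p\<^sub>2) (\<alpha> p\<^sub>3) = cross_ratio (\<alpha> p\<^sub>0) (\<alpha> p\<^sub>4) (\<alpha> p\<^sub>5) (\<alpha> p\<^sub>6) \<longleftrightarrow>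
    d p\<^sub>0 p\<^sub>2 * d p\<^sub>1 p\<^sub>3 * (d p\<^sub>4 p\<^sub>5 * d p\<^sub>0 p\<^sub>6) = d p\<^sub>0 p\<^sub>5 * d p\<^sub>4 p\<^sub>6 * (d p\<^sub>1 p\<^sub>2 * d p\<^sub>0 p\<^sub>3)"
    unfolding cross_ratio_def d_def[symmetric] using dist
    by (intro frac_eq_eq) (simp_all add: dnz)
  show ?thesis
    unfolding cr
  proof
    assume van: "\<forall>x\<in>Y. ?f p\<^sub>4 p\<^sub>5 p\<^sub>6 x = 0"
    \<comment> \<open>A generator of the normalized translates: lines \<open>p\<^sub>0\<close> and
      \<open>p\<^sub>1\<close> pass through the origin, hence so does \<open>p\<^sub>4\<close>. The
      entries at \<open>p\<^sub>2\<close> and \<open>p\<^sub>3\<close> solve the form of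
      \<open>p\<^sub>1\<close>, \<open>p\<^sub>2\<close>, \<open>p\<^sub>3\<close>; those at
      \<open>p\<^sub>5\<close> and \<open>p\<^sub>6\<close> are then forced by the other two
      forms.\<close>
    define x :: "'a^'n" where "x = (\<chi> l. if l = p\<^sub>2 then d p\<^sub>1 p\<^sub>2 else if l = p\<^sub>3 then d p\<^sub>1 p\<^sub>3
      else if l = p\<^sub>5 then d p\<^sub>1 p\<^sub>2 * d p\<^sub>0 p\<^sub>5 / d p\<^sub>0 p\<^sub>2
      else if l = p\<^sub>6 then d p\<^sub>1 p\<^sub>3 * d p\<^sub>0 p\<^sub>6 / d p\<^sub>0 p\<^sub>3 else 0)"
    have xs: "x $ p\<^sub>0 = 0" "x $ p\<^sub>1 = 0" "x $ p\<^sub>4 = 0" "x $ p\<^sub>2 = d p\<^sub>1 p\<^sub>2" "x $ p\<^sub>3 = d p\<^sub>1 p\<^sub>3"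
      "x $ p\<^sub>5 = d p\<^sub>1 p\<^sub>2 * d p\<^sub>0 p\<^sub>5 / d p\<^sub>0 p\<^sub>2" "x $ p\<^sub>6 = d p\<^sub>1 p\<^sub>3 * d p\<^sub>0 p\<^sub>6 / d p\<^sub>0 p\<^sub>3"
      using dist by (auto simp: x_def)
    have n: "d p\<^sub>0 p\<^sub>2 \<noteq> 0" "d p\<^sub>0 p\<^sub>3 \<noteq> 0"
      using dist by (auto intro!: dnz)
    have "x \<in> Y"
      using n by (simp add: Y triple_form_def d_def[symmetric] xs)
    with van have "?f p\<^sub>4 p\<^sub>5 p\<^sub>6 x = 0" by blast
    then have "x $ p\<^sub>6 * d p\<^sub>4 p\<^sub>5 = x $ p\<^sub>5 * d p\<^sub>4 p\<^sub>6"
      by (simp add: triple_form_def d_def[symmetric] xs(3))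
    moreover have "x $ p\<^sub>5 * d p\<^sub>0 p\<^sub>2 = d p\<^sub>1 p\<^sub>2 * d p\<^sub>0 p\<^sub>5"
      "x $ p\<^sub>6 * d p\<^sub>0 p\<^sub>3 = d p\<^sub>1 p\<^sub>3 * d p\<^sub>0 p\<^sub>6"
      using n by (simp_all add: xs)
    ultimately show "d p\<^sub>0 p\<^sub>2 * d p\<^sub>1 p\<^sub>3 * (d p\<^sub>4 p\<^sub>5 * d p\<^sub>0 p\<^sub>6) = d p\<^sub>0 p\<^sub>5 * d p\<^sub>4 p\<^sub>6 * (d p\<^sub>1 p\<^sub>2 * d p\<^sub>0 p\<^sub>3)"
      by algebra
  next
    assume eq: "d p\<^sub>0 p\<^sub>2 * d p\<^sub>1 p\<^sub>3 * (d p\<^sub>4 p\<^sub>5 * d p\<^sub>0 p\<^sub>6) = d p\<^sub>0 p\<^sub>5 * d p\<^sub>4 p\<^sub>6 * (d p\<^sub>1 p\<^sub>2 * d p\<^sub>0 p\<^sub>3)"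
    show "\<forall>x\<in>Y. ?f p\<^sub>4 p\<^sub>5 p\<^sub>6 x = 0"
    proof
      fix x assume x: "x \<in> Y"
      have "det2 (\<alpha> p\<^sub>0) (\<alpha> p\<^sub>1) \<noteq> 0"
        using dist by (intro nz) auto
      then obtain v where v: "scalar_product (\<alpha> p\<^sub>0) v = x $ p\<^sub>0" "scalar_product (\<alpha> p\<^sub>1) v = x $ p\<^sub>1"
        using cramer_2 by metis
      \<comment> \<open>Move the common point \<open>v\<close> of lines \<open>p\<^sub>0\<close> and
        \<open>p\<^sub>1\<close> to the origin; all forms keep their values.\<close>
      define y where "y = x - (\<chi> l. scalar_product (\<alpha> l) v)"
      have fy: "?f i j k y = ?f i j k x" for i j k
        by (simp add: y_def triple_form_minus triple_form_scalar_product)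
      have y01: "y $ p\<^sub>0 = 0" "y $ p\<^sub>1 = 0"
        using v by (simp_all add: y_def)
      have nzs: "d p\<^sub>0 p\<^sub>1 \<noteq> 0" "d p\<^sub>0 p\<^sub>2 \<noteq> 0" "d p\<^sub>0 p\<^sub>3 \<noteq> 0" "d p\<^sub>1 p\<^sub>3 \<noteq> 0"
        using dist by (auto intro!: dnz)
      have "?f p\<^sub>1 p\<^sub>2 p\<^sub>3 y = 0" "?f p\<^sub>0 p\<^sub>1 p\<^sub>4 y = 0" "?f p\<^sub>0 p\<^sub>2 p\<^sub>5 y = 0" "?f p\<^sub>0 p\<^sub>3 p\<^sub>6 y = 0"
        using x by (simp_all add: fy Y)
      then have ys: "y $ p\<^sub>2 * d p\<^sub>1 p\<^sub>3 = y $ p\<^sub>3 * d p\<^sub>1 p\<^sub>2" "y $ p\<^sub>4 = 0"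
        "y $ p\<^sub>5 * d p\<^sub>0 p\<^sub>2 = y $ p\<^sub>2 * d p\<^sub>0 p\<^sub>5" "y $ p\<^sub>6 * d p\<^sub>0 p\<^sub>3 = y $ p\<^sub>3 * d p\<^sub>0 p\<^sub>6"
        using nzs by (simp_all add: triple_form_def d_def[symmetric] y01)
      \<comment> \<open>The factors in front allow \<open>y $ p\<^sub>5\<close>,
        \<open>y $ p\<^sub>6\<close> and then \<open>y $ p\<^sub>2\<close> to be eliminated. What
        remains is \<open>y $ p\<^sub>3\<close> times the difference of the sides of
        \<open>eq\<close>.\<close>
      have "d p\<^sub>0 p\<^sub>2 * d p\<^sub>0 p\<^sub>3 * d p\<^sub>1 p\<^sub>3 * (- y $ p\<^sub>5 * d p\<^sub>4 p\<^sub>6 + y $ p\<^sub>6 * d p\<^sub>4 p\<^sub>5) = 0"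
        using ys(1,3,4) eq by algebra
      then have "?f p\<^sub>4 p\<^sub>5 p\<^sub>6 y = 0"
        using nzs by (simp add: triple_form_def d_def[symmetric] ys(2))
      then show "?f p\<^sub>4 p\<^sub>5 p\<^sub>6 x = 0"
        by (simp add: fy)
    qed
  qed
qed

section \<open>Multiplicity and rank of the given intersection\<close>

theorem proposition7:
  fixes H :: "'n::finite \<Rightarrow> ('a::field^2) set"
    and \<alpha> :: "'n \<Rightarrow> 'a^2"
    and p\<^sub>0 p\<^sub>1 p\<^sub>2 p\<^sub>3 p\<^sub>4 p\<^sub>5 p\<^sub>6 :: 'n
    and T :: "'n set set"
    and X :: "('a^'n) set"
  assumes "generic_arrangement H"
    and "\<And>p. normal_vector (H p) (\<alpha> p)"
    and "distinct [p\<^sub>0, p\<^sub>1, p\<^sub>2, p\<^sub>3, p\<^sub>4, p\<^sub>5, p\<^sub>6]"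
    and "T = {{p\<^sub>0, p\<^sub>1, p\<^sub>4}, {p\<^sub>0, p\<^sub>2, p\<^sub>5}, {p\<^sub>0, p\<^sub>3, p\<^sub>6}, {p\<^sub>1, p\<^sub>2, p\<^sub>3}, {p\<^sub>4, p\<^sub>5, p\<^sub>6}}"
    and "simple_intersection \<alpha> (D_triple \<alpha> ` T) X"
  shows "quintuple_point \<alpha> (D_triple \<alpha> ` T) X \<longleftrightarrow>
    cross_ratio (\<alpha> p\<^sub>0) (\<alpha> p\<^sub>1) (\<alpha> p\<^sub>2) (\<alpha> p\<^sub>3) =
    cross_ratio (\<alpha> p\<^sub>0) (\<alpha> p\<^sub>4) (\<alpha> p\<^sub>5) (\<alpha> p\<^sub>6)"
proof -
  note nz = generic_det2_nonzero[OF assms(1,2)]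
  note D = D_triple_eq[OF nz]
  \<comment> \<open>Multiplicity counts hyperplanes as sets: the five triples are distinct, and
    distinct triples give distinct hyperplanes.\<close>
  have "{p\<^sub>0, p\<^sub>1, p\<^sub>4} \<noteq> {p\<^sub>0, p\<^sub>2, p\<^sub>5}"
    "{p\<^sub>0, p\<^sub>1, p\<^sub>4} \<noteq> {p\<^sub>0, p\<^sub>3, p\<^sub>6}"
    "{p\<^sub>0, p\<^sub>1, p\<^sub>4} \<noteq> {p\<^sub>1, p\<^sub>2, p\<^sub>3}"
    "{p\<^sub>0, p\<^sub>1, p\<^sub>4} \<noteq> {p\<^sub>4, p\<^sub>5, p\<^sub>6}"
    "{p\<^sub>0, p\<^sub>2, p\<^sub>5} \<noteq> {p\<^sub>0, p\<^sub>3, p\<^sub>6}"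
    "{p\<^sub>0, p\<^sub>2, p\<^sub>5} \<noteq> {p\<^sub>1, p\<^sub>2, p\<^sub>3}"
    "{p\<^sub>0, p\<^sub>2, p\<^sub>5} \<noteq> {p\<^sub>4, p\<^sub>5, p\<^sub>6}"
    "{p\<^sub>0, p\<^sub>3, p\<^sub>6} \<noteq> {p\<^sub>1, p\<^sub>2, p\<^sub>3}"
    "{p\<^sub>0, p\<^sub>3, p\<^sub>6} \<noteq> {p\<^sub>4, p\<^sub>5, p\<^sub>6}"
    "{p\<^sub>1, p\<^sub>2, p\<^sub>3} \<noteq> {p\<^sub>4, p\<^sub>5, p\<^sub>6}"
    using assms(3) by (auto elim!: equalityE)
  then have card_T: "card T = 5"
    by (simp add: assms(4) card_insert_if)
  have "T \<subseteq> {L. card L = 3}"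
    using assms(3) by (auto simp: assms(4))
  moreover have "inj_on (D_triple \<alpha>) {L. card L = 3}"
    by (rule inj_on_D_triple) (rule nz)
  ultimately have "inj_on (D_triple \<alpha>) T"
    by (rule inj_on_subset[rotated])
  then have card: "card (D_triple \<alpha> ` T) = 5"
    by (simp add: card_image card_T)
  define Y where "Y = {x. triple_form \<alpha> p\<^sub>1 p\<^sub>2 p\<^sub>3 x = 0} \<inter> {x. triple_form \<alpha> p\<^sub>0 p\<^sub>1 p\<^sub>4 x = 0}
      \<inter> {x. triple_form \<alpha> p\<^sub>0 p\<^sub>2 p\<^sub>5 x = 0} \<inter> {x. triple_form \<alpha> p\<^sub>0 p\<^sub>3 p\<^sub>6 x = 0}"
  have "X = \<Inter>(D_triple \<alpha> ` T)"
    using assms(5) by (simp add: simple_intersection_def)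
  also have "\<dots> = Y \<inter> {x. triple_form \<alpha> p\<^sub>4 p\<^sub>5 p\<^sub>6 x = 0}"
    using assms(3) by (auto simp: assms(4) D Y_def)
  also have "codimension \<dots> = 4 \<longleftrightarrow> (\<forall>x\<in>Y. triple_form \<alpha> p\<^sub>4 p\<^sub>5 p\<^sub>6 x = 0)"
    by (rule rank_four_iff_last_form_vanishes[OF _ assms(3) Y_def]) (rule nz)
  also have "\<dots> \<longleftrightarrow> cross_ratio (\<alpha> p\<^sub>0) (\<alpha> p\<^sub>1) (\<alpha> p\<^sub>2) (\<alpha> p\<^sub>3) =
      cross_ratio (\<alpha> p\<^sub>0) (\<alpha> p\<^sub>4) (\<alpha> p\<^sub>5) (\<alpha> p\<^sub>6)"
    by (rule last_form_vanishes_iff[OF _ assms(3) Y_def]) (rule nz)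
  finally show ?thesis
    using card assms(5) by (simp add: quintuple_point_def)
qed

end
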